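(* Suppose that: $\Omega\subset\mathbb{R}^n$ is a nonempty closed convex set; $F:\mathbb{R}^n\to\mathbb{R}^m$ is differentiable with $\|J_F(x)-J_F(y)\|_2\le L_J\|x-y\|_2$ for all $x,y\in\mathbb{R}^n$; $h:\mathbb{R}^m\to\mathbb{R}$ is convex with $|h(z)-h(w)|\le L_{h,p}\|z-w\|_p$ for all $z,w\in\mathbb{R}^m$; there exists $f_{low}\in\mathbb{R}$ with $f(x)=h(F(x))\ge f_{low}$ for all $x\in\mathbb{R}^n$; each component $F_i$ ($i=1,\ldots,m$) is convex; $h$ is monotone, i.e. $h(u)\le h(v)$ whenever $u_i\le v_i$ for $i=1,\ldots,m$; and $f$ has a global minimizer $x^*$ on $\Omega$ with $$D_0:=\sup\{\|x-x^*\|_p: x\in\Omega,\ f(x)\le f(x_0)\}<+\infty .$$ Let $\{x_k\}$ be generated by the algorithm TRFD (described in the context) with parameters $\epsilon,\sigma,\alpha,\theta,\Delta_0,\Delta_*$, let $$T_f(\epsilon)=\inf\{k\in\{0,1,2,\ldots\}: f(x_k)-f(x^* )\le\Delta_*\epsilon\},$$ and let $FE_{T_f(\epsilon)-1}$ be the total number of evaluations of $F$ executed by TRFD up to (and including) iteration $T_f(\epsilon)-1$. If $\Delta_*\ge D_0$, then $$FE_{T_f(\epsilon)-1}\le(n+1)\Bigg[2\left[1+\frac{\left(\frac{L_J}{\sigma}+1\right)\beta}{\alpha\theta}\epsilon^{-1}\right]+\left\lceil\left|\log_2\left(\frac{4\max\{\sigma,L_J\}c_{2,p}(n)}{\sigma(1-\alpha)\theta}\right)\right|\right\rceil+\log_2\left(\frac{4L_{h,p}\max\{\sigma,L_J\}c_{p,2}(m)c_{2,p}(n)^2\Delta_0}{(1-\alpha)\theta}\epsilon^{-1}\right)\Bigg],$$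 where $$\beta=\max\left\{\frac{f(x_0)-f(x^* )}{\Delta_0},\ \frac{2\left(\frac{L_J}{\sigma}+1\right)\Delta_*L_{h,p}L_Jc_{p,2}(m)c_{2,p}(n)^2}{(1-\alpha)\theta}\right\}.$$
   Context: Notation: $n,m\ge1$ integers, $p\in\{1,2,3,\ldots\}\cup\{\infty\}$, $\|\cdot\|_p$ the $p$-norm (for matrices $\|\cdot\|_2$ is the spectral norm), $J_F$ the Jacobian of $F$, $f=h\circ F$, $\Omega-\{x\}=\{s\in\mathbb{R}^n:x+s\in\Omega\}$, $[A]_j$ the $j$-th column of $A$, $e_j$ the $j$-th canonical vector. $c_{2,p}(n),c_{p,2}(m)\ge1$ are fixed constants with $\|x\|_2\le c_{2,p}(n)\|x\|_p$ for all $x\in\mathbb{R}^n$ and $\|z\|_p\le c_{p,2}(m)\|z\|_2$ for all $z\in\mathbb{R}^m$. $L_{h,p},L_J>0$. For $r>0$, $x\in\Omega$, $A\in\mathbb{R}^{m\times n}$, $$\eta_{p,r}(x;A)=\tfrac1r\Big(h(F(x))-\min_{s\in\Omega-\{x\},\,\|s\|_p\le r}h(F(x)+As)\Big).$$ Algorithm TRFD. Step 0: given $x_0\in\Omega$, $\epsilon>0$, $\sigma>0$, $\alpha\in(0,1)$, $\theta\in(0,1]$ and $L_{h,p}$, set $\tau_0=\epsilon/(L_{h,p}\sigma c_{p,2}(m)c_{2,p}(n)\sqrt n)$, choose $\Delta_0,\Delta_*$ with $\tau_0\sqrt n\le\Delta_0\le\Delta_*$, set $k:=0$. Step 1: construct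 $A_k\in\mathbb{R}^{m\times n}$ with $[A_k]_j=(F(x_k+\tau_ke_j)-F(x_k))/\tau_k$, $j=1,\ldots,n$, and compute $\eta_{p,\Delta_*}(x_k;A_k)$. Step 2: if $\eta_{p,\Delta_*}(x_k;A_k)\ge\epsilon/2$ go to Step 3; otherwise set $x_{k+1}=x_k$, $\Delta_{k+1}=\Delta_k$, $\tau_{k+1}=\frac12\tau_k$, $k:=k+1$ and go to Step 1. Step 3: let $d_k^*$ minimize $h(F(x_k)+A_kd)$ subject to $\|d\|_p\le\Delta_k$, $x_k+d\in\Omega$; compute any $d_k$ with $\|d_k\|_p\le\Delta_k$, $x_k+d_k\in\Omega$ and $h(F(x_k))-h(F(x_k)+A_kd_k)\ge\theta[h(F(x_k))-h(F(x_k)+A_kd_k^* )]$. Step 4: compute $\rho_k=\frac{h(F(x_k))-h(F(x_k+d_k))}{h(F(x_k))-h(F(x_k)+A_kd_k)}$; if $\rho_k\ge\alpha$, set $x_{k+1}=x_k+d_k$, $\Delta_{k+1}=\min\{2\Delta_k,\Delta_*\}$, $\tau_{k+1}=\tau_k$, $k:=k+1$ and go to Step 1. Step 5: (if $\rho_k<\alpha$) set $x_{k+1}=x_k$, $\Delta_{k+1}=\frac12\Delta_k$; if $\tau_k\sqrt n\le\Delta_{k+1}$, set $\tau_{k+1}=\tau_k$, $A_{k+1}=A_k$, $k:=k+1$ and go to Step 3; otherwise set $\tau_{k+1}=\frac12\tau_k$, $k:=k+1$ and go to Step 1. (No stopping test: the algorithm generates infinite sequences.) Counting of evaluations: $F(x_0)$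 is evaluated once at the start; constructing $A_k$ at Step 1 costs the $n$ evaluations $F(x_k+\tau_ke_j)$; Step 4 costs the single evaluation $F(x_k+d_k)$; already computed values $F(x_k)$ are stored and reused, and no evaluation is needed when $A_{k+1}=A_k$ is reused. Convention: $\inf\emptyset=+\infty$ (the claim includes that $T_f(\epsilon)$ is finite); if $T_f(\epsilon)=0$ then no iteration is counted. *)

theory Defs
  imports "HOL-Analysis.Analysis" "HOL-Library.Extended_Nat"
begin

text \<open>Meaningful for \<open>p \<ge> 1\<close> only.\<close>

definition pnorm :: "enat \<Rightarrow> real^'n \<Rightarrow> real" where
  "pnorm p x = (case p of enat q \<Rightarrow> root q (\<Sum>i\<in>UNIV. \<bar>x $ i\<bar> ^ q) | \<infinity> \<Rightarrow> infnorm x)"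

definition spectral_norm :: "real^'n^'m \<Rightarrow> real" where
  "spectral_norm A = onorm ((*v) A)"

definition steps :: "enat \<Rightarrow> (real^'n) set \<Rightarrow> real \<Rightarrow> real^'n \<Rightarrow> (real^'n) set" where
  "steps p \<Omega> r x = {s. x + s \<in> \<Omega> \<and> pnorm p s \<le> r}"

text \<open>For \<open>\<Omega>\<close> closed, \<open>x \<in> \<Omega>\<close>, \<open>r > 0\<close>, \<open>p \<ge> 1\<close> and \<open>h\<close> continuous, the infimum is taken
  over a nonempty compact set and is therefore a minimum.\<close>

definition eta ::
  "enat \<Rightarrow> (real^'n) set \<Rightarrow> (real^'n \<Rightarrow> real^'m) \<Rightarrow> (real^'m \<Rightarrow> real) \<Rightarrow> real \<Rightarrow> real^'n \<Rightarrow> real^'n^'m \<Rightarrow> real"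
  where
  "eta p \<Omega> F h r x A = (1 / r) * (h (F x) - (INF s\<in>steps p \<Omega> r x. h (F x + A *v s)))"

definition fd_jacobian :: "(real^'n \<Rightarrow> real^'m) \<Rightarrow> real \<Rightarrow> real^'n \<Rightarrow> real^'n^'m" where
  "fd_jacobian F t x = (\<chi> i j. (F (x + t *\<^sub>R axis j 1) $ i - F x $ i) / t)"

text \<open>The control flow is recorded by \<open>fresh\<close>: iteration \<open>k\<close> is entered at Step 1 if \<open>fresh k\<close>,
  and directly at Step 3, with the matrix of the previous iteration, otherwise.
  If iteration \<open>k\<close> returns to Step 1 from Step 2, then \<open>d k\<close> is never computed, and it is
  left unconstrained below.\<close>

definition reaches_step3 ::
  "enat \<Rightarrow> (real^'n) set \<Rightarrow> (real^'n \<Rightarrow> real^'m) \<Rightarrow> (real^'m \<Rightarrow> real) \<Rightarrow> real \<Rightarrow> real \<Rightarrow>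
   (nat \<Rightarrow> real^'n) \<Rightarrow> (nat \<Rightarrow> real^'n^'m) \<Rightarrow> (nat \<Rightarrow> bool) \<Rightarrow> nat \<Rightarrow> bool" where
  "reaches_step3 p \<Omega> F h \<epsilon> \<Delta>max x A fresh k \<longleftrightarrow>
     \<not> fresh k \<or> eta p \<Omega> F h \<Delta>max (x k) (A k) \<ge> \<epsilon> / 2"

definition inexact_step ::
  "enat \<Rightarrow> (real^'n) set \<Rightarrow> (real^'n \<Rightarrow> real^'m) \<Rightarrow> (real^'m \<Rightarrow> real) \<Rightarrow> real \<Rightarrow>
   real \<Rightarrow> real^'n \<Rightarrow> real^'n^'m \<Rightarrow> real^'n \<Rightarrow> bool" where
  "inexact_step p \<Omega> F h \<theta> r x A d \<longleftrightarrow>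
     d \<in> steps p \<Omega> r x \<and>
     (\<exists>ds. is_arg_min (\<lambda>s. h (F x + A *v s)) (\<lambda>s. s \<in> steps p \<Omega> r x) ds \<and>
        h (F x) - h (F x + A *v d) \<ge> \<theta> * (h (F x) - h (F x + A *v ds)))"

definition rho ::
  "(real^'n \<Rightarrow> real^'m) \<Rightarrow> (real^'m \<Rightarrow> real) \<Rightarrow> real^'n \<Rightarrow> real^'n^'m \<Rightarrow> real^'n \<Rightarrow> real" where
  "rho F h x A d = (h (F x) - h (F (x + d))) / (h (F x) - h (F x + A *v d))"

text \<open>The starting point and the initial radius are \<open>x 0\<close> and \<open>\<Delta> 0\<close>; \<open>\<Delta>max\<close> is the upper bound
  \<open>\<Delta>\<^sub>*\<close> on the radii, \<open>c2p\<close> stands for \<open>c\<^bsub>2,p\<^esub>(n)\<close> and \<open>cp2\<close> for \<open>c\<^bsub>p,2\<^esub>(m)\<close>.\<close>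

definition trfd ::
  "enat \<Rightarrow> (real^'n) set \<Rightarrow> (real^'n \<Rightarrow> real^'m) \<Rightarrow> (real^'m \<Rightarrow> real) \<Rightarrow>
   real \<Rightarrow> real \<Rightarrow> real \<Rightarrow> real \<Rightarrow> real \<Rightarrow> real \<Rightarrow> real \<Rightarrow> real \<Rightarrow>
   (nat \<Rightarrow> real^'n) \<Rightarrow> (nat \<Rightarrow> real) \<Rightarrow> (nat \<Rightarrow> real) \<Rightarrow> (nat \<Rightarrow> real^'n^'m) \<Rightarrow> (nat \<Rightarrow> real^'n) \<Rightarrow>
   (nat \<Rightarrow> bool) \<Rightarrow> bool" where
  "trfd p \<Omega> F h Lh c2p cp2 \<epsilon> \<sigma> \<alpha> \<theta> \<Delta>max x \<Delta> \<tau> A d fresh \<longleftrightarrow>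
     x 0 \<in> \<Omega> \<and>
     \<tau> 0 = \<epsilon> / (Lh * \<sigma> * cp2 * c2p * sqrt (real CARD('n))) \<and>
     \<tau> 0 * sqrt (real CARD('n)) \<le> \<Delta> 0 \<and> \<Delta> 0 \<le> \<Delta>max \<and>
     fresh 0 \<and>
     (\<forall>k.
       (fresh k \<longrightarrow> A k = fd_jacobian F (\<tau> k) (x k)) \<and>
       (if reaches_step3 p \<Omega> F h \<epsilon> \<Delta>max x A fresh k then
          inexact_step p \<Omega> F h \<theta> (\<Delta> k) (x k) (A k) (d k) \<and>
          (if rho F h (x k) (A k) (d k) \<ge> \<alpha> then
             x (Suc k) = x k + d k \<and> \<Delta> (Suc k) = min (2 * \<Delta> k) \<Delta>max \<and>
             \<tau> (Suc k) = \<tau> k \<and> fresh (Suc k)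
           else
             x (Suc k) = x k \<and> \<Delta> (Suc k) = \<Delta> k / 2 \<and>
             (if \<tau> k * sqrt (real CARD('n)) \<le> \<Delta> (Suc k) then
                \<tau> (Suc k) = \<tau> k \<and> A (Suc k) = A k \<and> \<not> fresh (Suc k)
              else
                \<tau> (Suc k) = \<tau> k / 2 \<and> fresh (Suc k)))
        else
          x (Suc k) = x k \<and> \<Delta> (Suc k) = \<Delta> k \<and> \<tau> (Suc k) = \<tau> k / 2 \<and> fresh (Suc k)))"

text \<open>Number of evaluations of \<open>F\<close> before iteration \<open>N\<close> starts: one for \<open>F (x 0)\<close>, and in each
  iteration \<open>k < N\<close>, \<open>n\<close> for a new \<open>A k\<close> in Step 1 and one for \<open>F (x k + d k)\<close> in Step 4.
  The values \<open>F (x k)\<close> are stored and never recomputed.\<close>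

definition evals_before ::
  "enat \<Rightarrow> (real^'n) set \<Rightarrow> (real^'n \<Rightarrow> real^'m) \<Rightarrow> (real^'m \<Rightarrow> real) \<Rightarrow> real \<Rightarrow> real \<Rightarrow>
   (nat \<Rightarrow> real^'n) \<Rightarrow> (nat \<Rightarrow> real^'n^'m) \<Rightarrow> (nat \<Rightarrow> bool) \<Rightarrow> nat \<Rightarrow> nat" where
  "evals_before p \<Omega> F h \<epsilon> \<Delta>max x A fresh N =
     1 + (\<Sum>k<N. (if fresh k then CARD('n) else 0) +
                 (if reaches_step3 p \<Omega> F h \<epsilon> \<Delta>max x A fresh k then 1 else 0))"

definition hitting_time :: "(real^'n \<Rightarrow> real) \<Rightarrow> (nat \<Rightarrow> real^'n) \<Rightarrow> real^'n \<Rightarrow> real \<Rightarrow> enat" where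
  "hitting_time f x xstar tol = Inf (enat ` {k. f (x k) - f xstar \<le> tol})"

end

theory Submission
  imports Defs
begin

text \<open>Let \<open>\<delta>\<^sub>k = f (x k) - f xstar\<close>. Since the components of \<open>F\<close> are convex and \<open>h\<close> is monotone,
  the linearized model at \<open>x k\<close> lies below \<open>f\<close>; as \<open>xstar\<close> is within \<open>\<Delta>max\<close> of \<open>x k\<close>, the quotient
  \<open>\<delta>\<^sub>k / \<Delta>max\<close> is at most the criticality measure \<open>eta\<close> of \<open>A k\<close> plus a finite-difference error
  proportional to \<open>\<tau> k\<close>. This has three consequences while \<open>\<delta>\<^sub>k > \<Delta>max * \<epsilon>\<close>. A return from Step 2
  forces \<open>\<tau> 0 < LJ / \<sigma> * \<tau> k\<close>, so there are at most \<open>1 + log 2 (max \<sigma> LJ / \<sigma>)\<close> of them.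
  A rejected step forces a radius proportional to \<open>eta\<close>, whence \<open>\<delta>\<^sub>k \<le> \<beta> * \<Delta> k\<close> and a lower bound
  on all radii. An accepted step decreases \<open>\<delta>\<close> by a multiple of \<open>\<delta>\<^sub>k\<^sup>2\<close>, so \<open>1 / \<delta>\<close> grows linearly and
  the number of accepted steps is \<open>O(1 / \<epsilon>)\<close>. Rejections halve the radius and acceptances at most
  double it, so the former exceed the latter by at most a logarithm. Every iteration costs at
  most \<open>n + 1\<close> evaluations; the evaluation of \<open>F (x 0)\<close> is absorbed by the slack in the
  bound for Step 2.\<close>

section \<open>Facts on the p-norms and the spectral norm\<close>

lemma pnorm_scaleR:
  fixes v :: "real^'n"
  assumes "1 \<le> p"
  shows "pnorm p (t *\<^sub>R v) = \<bar>t\<bar> * pnorm p v"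
proof (cases p)
  case (enat q)
  with assms have "0 < q" by (auto simp: one_enat_def)
  then show ?thesis
    using enat by (simp add: pnorm_def abs_mult power_mult_distrib real_root_mult
        real_root_power_cancel flip: sum_distrib_left)
qed (simp add: pnorm_def infnorm_mul)

lemma pnorm_minus_commute:
  fixes v w :: "real^'n"
  assumes "1 \<le> p"
  shows "pnorm p (v - w) = pnorm p (w - v)"
  using pnorm_scaleR[OF assms, of "-1" "w - v"] by simp

lemma norm_matrix_vector_le_spectral: "norm (A *v s) \<le> spectral_norm A * norm s"
  unfolding spectral_norm_def by (rule onorm[OF matrix_vector_mul_bounded_linear])

text \<open>Cauchy-Schwarz against the vector of ones.\<close>

lemma sum_abs_le_sqrt_card_norm:
  fixes s :: "real^'n"
  shows "(\<Sum>j\<in>UNIV. \<bar>s $ j\<bar>) \<le> sqrt (real CARD('n)) * norm s"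
  using L2_set_mult_ineq[of "\<lambda>j. s $ j" "\<lambda>_. 1" UNIV]
  by (simp add: norm_vec_def L2_set_def mult.commute)

section \<open>Counting three kinds of steps for abstract sequences\<close>

text \<open>If \<open>s\<close>, \<open>w\<close>, \<open>u\<close> steps of the three kinds occur,
  then \<open>s \<le> 1 + 1 / (c * tol)\<close>, \<open>w \<le> log 2 (2 * b)\<close> and
  \<open>u \<le> s + log 2 (\<Delta> 0 / \<Delta>min)\<close>. In the sum \<open>s\<close> appears
  twice, whence the factor 2.\<close>

lemma iteration_count:
  fixes \<delta> \<Delta> \<tau> :: "nat \<Rightarrow> real"
  assumes pos: "0 < c" "0 < tol" "0 < \<Delta>min" "1 \<le> b" "\<And>k. 0 < \<tau> k"
    and gap: "\<And>k. k < N \<Longrightarrow> tol < \<delta> k"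
    and step: "\<And>k. k < N \<Longrightarrow>
      \<delta> (Suc k) \<le> \<delta> k - c * (\<delta> k)\<^sup>2 \<and> \<Delta> (Suc k) \<le> 2 * \<Delta> k \<and> \<tau> (Suc k) \<le> \<tau> k \<or>
      \<delta> (Suc k) = \<delta> k \<and> \<Delta> (Suc k) = \<Delta> k \<and> \<tau> (Suc k) = \<tau> k / 2 \<and> \<tau> 0 \<le> b * \<tau> k \<or>
      \<delta> (Suc k) = \<delta> k \<and> \<Delta> (Suc k) = \<Delta> k / 2 \<and> \<tau> (Suc k) \<le> \<tau> k"
    and final: "\<Delta>min \<le> \<Delta> N"
  shows "real N \<le> 2 * (1 + 1 / (c * tol)) + log 2 (2 * b) + log 2 (\<Delta> 0 / \<Delta>min)"
proof -
  \<comment> \<open>\<open>s\<close>, \<open>w\<close> and \<open>u\<close> count the steps of the three kinds in \<open>step\<close>, in that order.\<close>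
  have inv: "\<exists>s u w. k = s + u + w \<and> \<Delta> k * 2 ^ u \<le> \<Delta> 0 * 2 ^ s \<and> \<tau> k * 2 ^ w \<le> \<tau> 0 \<and>
      2 ^ w \<le> 2 * b \<and> (k < N \<longrightarrow> c * real s * \<delta> k \<le> 1) \<and> real s \<le> 1 + 1 / (c * tol)"
    if "k \<le> N" for k
    using that
  proof (induction k)
    case 0
    show ?case
      by (intro exI[of _ 0]) (use pos in auto)
  next
    case (Suc k)
    then have k: "k < N" by simp
    from Suc obtain s u w where IH: "k = s + u + w" "\<Delta> k * 2 ^ u \<le> \<Delta> 0 * 2 ^ s"
      "\<tau> k * 2 ^ w \<le> \<tau> 0" "2 ^ w \<le> 2 * b" "c * real s * \<delta> k \<le> 1" "real s \<le> 1 + 1 / (c * tol)"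
      by auto
    consider (dec) "\<delta> (Suc k) \<le> \<delta> k - c * (\<delta> k)\<^sup>2" "\<Delta> (Suc k) \<le> 2 * \<Delta> k" "\<tau> (Suc k) \<le> \<tau> k"
      | (ref) "\<delta> (Suc k) = \<delta> k" "\<Delta> (Suc k) = \<Delta> k" "\<tau> (Suc k) = \<tau> k / 2" "\<tau> 0 \<le> b * \<tau> k"
      | (shrink) "\<delta> (Suc k) = \<delta> k" "\<Delta> (Suc k) = \<Delta> k / 2" "\<tau> (Suc k) \<le> \<tau> k"
      using step[OF k] by blast
    then show ?case
    proof cases
      case dec
      \<comment> \<open>The earlier steps alone satisfy \<open>s \<le> 1 / (c * tol)\<close>. The
        step being counted adds the 1, so this bound also covers the last step, after which the gap
        may be below \<open>tol\<close>.\<close>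
      have "real s * (c * tol) \<le> real s * (c * \<delta> k)"
        using pos gap[OF k] by (intro mult_left_mono) auto
      also have "\<dots> \<le> 1" using IH(5) by (simp add: mult_ac)
      finally have s: "real s \<le> 1 / (c * tol)"
        using pos by (simp add: pos_le_divide_eq)
      \<comment> \<open>This is the growth of \<open>1 / \<delta>\<close> written without division.
        The relative decrease is at least \<open>y\<close>, and \<open>s * y \<le> 1\<close> bounds
        the left side by \<open>(1 + y) * (1 - y)\<close>. That \<open>1 - y\<close> is positive
        comes from \<open>\<delta> (Suc k) > 0\<close>, hence the guard.\<close>
      have "c * real (Suc s) * \<delta> (Suc k) \<le> 1" if "Suc k < N"
      proof -
        have \<delta>: "0 < \<delta> k" "0 < \<delta> (Suc k)"
          using gap[OF k] gap[OF that] pos by linarith+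
        define y where "y = c * \<delta> k"
        have "\<delta> (Suc k) \<le> \<delta> k * (1 - y)"
          using dec(1) by (simp add: y_def algebra_simps power2_eq_square)
        moreover from this \<delta> have y1: "0 < 1 - y"
          by (metis order_less_le_trans zero_less_mult_pos)
        ultimately have "c * real (Suc s) * \<delta> (Suc k) \<le> c * real (Suc s) * (\<delta> k * (1 - y))"
          using pos by (intro mult_left_mono) auto
        also have "\<dots> = (real s * y + y) * (1 - y)"
          by (simp add: y_def algebra_simps)
        also have "\<dots> \<le> (1 + y) * (1 - y)"
          using IH(5) y1 by (intro mult_right_mono) (auto simp: y_def mult_ac)
        also have "\<dots> \<le> 1" by (simp add: algebra_simps)
        finally show ?thesis .
      qed
      moreover have "\<Delta> (Suc k) * 2 ^ u \<le> \<Delta> 0 * 2 ^ Suc s"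
        using order_trans[OF mult_right_mono[OF dec(2), of "2 ^ u"], of "2 * (\<Delta> 0 * 2 ^ s)"] IH(2)
        by (simp add: mult_ac)
      moreover have "\<tau> (Suc k) * 2 ^ w \<le> \<tau> 0"
        by (rule order_trans[OF mult_right_mono[OF dec(3)] IH(3)]) simp
      ultimately show ?thesis
        using IH s by - (rule exI[of _ "Suc s"], rule exI[of _ u], rule exI[of _ w], auto)
    next
      case ref
      \<comment> \<open>The lower bound on \<open>\<tau> k\<close> holds before the halving, so the
        earlier halvings give \<open>2 ^ w \<le> b\<close> and the new one brings
        \<open>2 * b\<close>.\<close>
      have "\<tau> k * 2 ^ w \<le> \<tau> k * b"
        using IH(3) ref(4) by (simp add: mult.commute)
      then have "2 ^ w \<le> b" using pos(5)[of k] by simp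
      moreover have "\<tau> (Suc k) * 2 ^ Suc w \<le> \<tau> 0" using IH(3) unfolding ref(3) by simp
      ultimately show ?thesis
        using IH ref by - (rule exI[of _ s], rule exI[of _ u], rule exI[of _ "Suc w"], auto)
    next
      case shrink
      have "\<tau> (Suc k) * 2 ^ w \<le> \<tau> 0"
        by (rule order_trans[OF mult_right_mono[OF shrink(3)] IH(3)]) simp
      moreover have "\<Delta> (Suc k) * 2 ^ Suc u \<le> \<Delta> 0 * 2 ^ s" using IH(2) unfolding shrink(2) by simp
      ultimately show ?thesis
        using IH shrink by - (rule exI[of _ s], rule exI[of _ "Suc u"], rule exI[of _ w], auto)
    qed
  qed
  from inv[of N] obtain s u w where N: "N = s + u + w" "\<Delta> N * 2 ^ u \<le> \<Delta> 0 * 2 ^ s"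
    "2 ^ w \<le> 2 * b" "real s \<le> 1 + 1 / (c * tol)" by auto
  have "\<Delta>min * 2 ^ u \<le> \<Delta> 0 * 2 ^ s"
    by (rule order_trans[OF mult_right_mono[OF final] N(2)]) simp
  then have *: "2 ^ u \<le> \<Delta> 0 / \<Delta>min * 2 ^ s"
    using pos by (simp add: field_simps)
  then have \<Delta>0: "0 < \<Delta> 0 / \<Delta>min"
    by (metis less_le_trans zero_less_mult_pos2 zero_less_numeral zero_less_power)
  from * have "log 2 (2 ^ u) \<le> log 2 (\<Delta> 0 / \<Delta>min * 2 ^ s)"
    by (intro log_mono) auto
  also have "\<dots> = log 2 (\<Delta> 0 / \<Delta>min) + real s"
    using \<Delta>0 by (subst log_mult) (auto simp: log_nat_power)
  finally have "real u \<le> log 2 (\<Delta> 0 / \<Delta>min) + real s"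
    by (simp add: log_nat_power)
  moreover have "log 2 (2 ^ w) \<le> log 2 (2 * b)"
    using N(3) by (intro log_mono) auto
  then have "real w \<le> log 2 (2 * b)" by (simp add: log_nat_power)
  ultimately show ?thesis using N(1,4) by simp
qed

section \<open>Model errors and the criticality measure of a convex composite function\<close>

locale smooth_composite =
  fixes p :: enat
    and \<Omega> :: "(real^'n) set"
    and F :: "real^'n \<Rightarrow> real^'m"
    and h :: "real^'m \<Rightarrow> real"
    and Lh LJ c2p cp2 :: real
  assumes p: "1 \<le> p"
    and c2p: "1 \<le> c2p" "\<And>v :: real^'n. norm v \<le> c2p * pnorm p v"
    and cp2: "1 \<le> cp2" "\<And>z :: real^'m. pnorm p z \<le> cp2 * norm z"
    and Omega: "convex \<Omega>"
    and F_diff: "\<And>y. F differentiable (at y)"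
    and LJ: "0 < LJ"
      "\<And>y z. spectral_norm (jacobian F (at y) - jacobian F (at z)) \<le> LJ * norm (y - z)"
    and h_convex: "convex_on UNIV h"
    and Lh: "0 < Lh" "\<And>z w. \<bar>h z - h w\<bar> \<le> Lh * pnorm p (z - w)"
    and F_convex: "\<And>i. convex_on UNIV (\<lambda>y. F y $ i)"
    and h_mono: "\<And>u v. (\<And>i. u $ i \<le> v $ i) \<Longrightarrow> h u \<le> h v"
begin

lemma h_lipschitz: "\<bar>h z - h w\<bar> \<le> Lh * cp2 * norm (z - w)"
  by (rule order_trans[OF Lh(2)]) (use Lh(1) cp2(2)[of "z - w"] in \<open>simp add: mult.assoc\<close>)

lemma norm_le_radius:
  fixes s :: "real^'n"
  shows "pnorm p s \<le> r \<Longrightarrow> norm s \<le> c2p * r"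
  using c2p(2)[of s] mult_left_mono[of "pnorm p s" r c2p] c2p(1) by linarith

lemma F_line_derivative:
  "((\<lambda>t. F (y + t *\<^sub>R s)) has_derivative (\<lambda>e. e *\<^sub>R (jacobian F (at (y + t *\<^sub>R s)) *v s))) (at t)"
proof -
  have "(F has_derivative (*v) (jacobian F (at (y + t *\<^sub>R s)))) (at (y + t *\<^sub>R s))"
    using F_diff jacobian_works by blast
  then have "(F \<circ> (\<lambda>t. y + t *\<^sub>R s) has_derivative
      (*v) (jacobian F (at (y + t *\<^sub>R s))) \<circ> (\<lambda>e. e *\<^sub>R s)) (at t)"
    by (intro diff_chain_at) (auto intro!: derivative_eq_intros)
  then show ?thesis by (simp add: o_def matrix_vector_mult_scaleR)
qed

text \<open>The remainder \<open>w\<close> is tested against itself, which reduces the vector-valued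
  estimate to the monotonicity of a real function on \<open>[0, 1]\<close>.\<close>

lemma taylor_bound: "norm (F (y + s) - F y - jacobian F (at y) *v s) \<le> LJ / 2 * (norm s)\<^sup>2"
proof -
  let ?J = "\<lambda>z. jacobian F (at z)"
  define w where "w = F (y + s) - F y - ?J y *v s"
  \<comment> \<open>\<open>\<phi> 0 = 0\<close>, while \<open>\<phi> 1\<close> is the squared norm
    of \<open>w\<close> minus the desired bound times \<open>norm w\<close>. The Lipschitz bound on
    the Jacobian makes the derivative nonpositive.\<close>
  define \<phi> where "\<phi> t = (F (y + t *\<^sub>R s) - F y - t *\<^sub>R (?J y *v s)) \<bullet> w
    - LJ / 2 * t\<^sup>2 * (norm s)\<^sup>2 * norm w" for t
  have "\<phi> 1 \<le> \<phi> 0"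
  proof (rule DERIV_nonpos_imp_nonincreasing[where f = \<phi>])
    fix t :: real assume t: "0 \<le> t" "t \<le> 1"
    let ?D = "(?J (y + t *\<^sub>R s) *v s - ?J y *v s) \<bullet> w - LJ * t * (norm s)\<^sup>2 * norm w"
    have "((\<lambda>t. (F (y + t *\<^sub>R s) - F y - t *\<^sub>R (?J y *v s)) \<bullet> w) has_derivative
        (\<lambda>e. (e *\<^sub>R (?J (y + t *\<^sub>R s) *v s) - 0 - e *\<^sub>R (?J y *v s)) \<bullet> w)) (at t)"
      by (intro has_derivative_inner_left has_derivative_diff F_line_derivative has_derivative_const
          has_derivative_scaleR_left has_derivative_ident)
    then have "((\<lambda>t. (F (y + t *\<^sub>R s) - F y - t *\<^sub>R (?J y *v s)) \<bullet> w) has_real_derivative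
        (?J (y + t *\<^sub>R s) *v s - ?J y *v s) \<bullet> w) (at t)"
      by (simp add: has_field_derivative_def mult_commute_abs flip: scaleR_diff_right)
    then have "DERIV \<phi> t :> ?D"
      unfolding \<phi>_def by (rule DERIV_diff) (auto intro!: derivative_eq_intros)
    moreover have "?D \<le> 0"
    proof -
      have "(?J (y + t *\<^sub>R s) *v s - ?J y *v s) \<bullet> w \<le> norm ((?J (y + t *\<^sub>R s) - ?J y) *v s) * norm w"
        by (simp add: matrix_vector_mult_diff_rdistrib norm_cauchy_schwarz)
      also have "\<dots> \<le> (spectral_norm (?J (y + t *\<^sub>R s) - ?J y) * norm s) * norm w"
        by (intro mult_right_mono norm_matrix_vector_le_spectral) auto
      also have "\<dots> \<le> (LJ * norm (t *\<^sub>R s) * norm s) * norm w"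
        using LJ(2)[of "y + t *\<^sub>R s" y] by (intro mult_right_mono) auto
      finally show ?thesis using t by (simp add: power2_eq_square mult_ac)
    qed
    ultimately show "\<exists>D. DERIV \<phi> t :> D \<and> D \<le> 0" by blast
  qed simp
  then have "norm w * norm w \<le> LJ / 2 * (norm s)\<^sup>2 * norm w"
    by (simp add: \<phi>_def w_def flip: power2_norm_eq_inner power2_eq_square)
  then have "norm w \<le> LJ / 2 * (norm s)\<^sup>2"
    using LJ(1) by (cases "norm w = 0") auto
  then show ?thesis by (simp add: w_def)
qed

text \<open>Each column of the error is a Taylor remainder for the step \<open>t\<close> along an
  axis, divided by \<open>t\<close>. Summing the columns with weights \<open>s $ j\<close> costs the
  factor \<open>sqrt n\<close>.\<close>

lemma fd_jacobian_error:
  assumes t: "0 < t"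
  shows "norm (fd_jacobian F t y *v s - jacobian F (at y) *v s)
    \<le> LJ / 2 * (t * sqrt (real CARD('n))) * norm s"
proof -
  let ?J = "jacobian F (at y)"
  \<comment> \<open>\<open>c j\<close> is column \<open>j\<close> of
    \<open>fd_jacobian F t y - ?J\<close>.\<close>
  define c where "c j = (1 / t) *\<^sub>R (F (y + t *\<^sub>R axis j 1) - F y - ?J *v (t *\<^sub>R axis j 1))" for j
  have c: "norm (c j) \<le> LJ / 2 * t" for j
  proof -
    have "norm (c j) \<le> (1 / t) * (LJ / 2 * (norm (t *\<^sub>R (axis j 1 :: real^'n)))\<^sup>2)"
      unfolding c_def norm_scaleR using t taylor_bound[of y "t *\<^sub>R axis j 1"]
      by (intro mult_mono) auto
    then show ?thesis using t by (simp add: power2_eq_square)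
  qed
  have col: "(?J *v axis j 1) $ i = ?J $ i $ j" for i j
    by (simp add: matrix_vector_mul_component inner_axis)
  have "fd_jacobian F t y *v s - ?J *v s = (\<Sum>j\<in>UNIV. (s $ j) *\<^sub>R c j)"
    unfolding vec_eq_iff
  proof
    fix i
    have "(fd_jacobian F t y *v s - ?J *v s) $ i
      = (\<Sum>j\<in>UNIV. (fd_jacobian F t y $ i $ j - ?J $ i $ j) * s $ j)"
      by (simp add: matrix_vector_mult_def sum_subtractf algebra_simps)
    also have "\<dots> = (\<Sum>j\<in>UNIV. (s $ j) *\<^sub>R c j) $ i"
      unfolding sum_component
    proof (rule sum.cong[OF refl])
      fix j
      show "(fd_jacobian F t y $ i $ j - ?J $ i $ j) * s $ j = ((s $ j) *\<^sub>R c j) $ i"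
        using t by (simp add: c_def fd_jacobian_def matrix_vector_mult_scaleR col field_simps)
    qed
    finally show "(fd_jacobian F t y *v s - ?J *v s) $ i = (\<Sum>j\<in>UNIV. (s $ j) *\<^sub>R c j) $ i" .
  qed
  then have "norm (fd_jacobian F t y *v s - ?J *v s) \<le> (\<Sum>j\<in>UNIV. norm ((s $ j) *\<^sub>R c j))"
    by (simp only: norm_sum)
  also have "\<dots> \<le> (\<Sum>j\<in>UNIV. \<bar>s $ j\<bar> * (LJ / 2 * t))"
    unfolding norm_scaleR by (intro sum_mono mult_left_mono[OF c]) simp
  also have "\<dots> = (LJ / 2 * t) * (\<Sum>j\<in>UNIV. \<bar>s $ j\<bar>)"
    by (simp add: sum_distrib_left mult.commute)
  also have "\<dots> \<le> (LJ / 2 * t) * (sqrt (real CARD('n)) * norm s)"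
    using t LJ(1) by (intro mult_left_mono sum_abs_le_sqrt_card_norm) auto
  finally show ?thesis by (simp add: mult_ac)
qed

text \<open>Along the line through \<open>y\<close> in direction \<open>s\<close> every convex
  component of \<open>F\<close> lies above its tangent; monotonicity of \<open>h\<close> passes this
  on to \<open>h \<circ> F\<close>.\<close>

lemma linearization_below: "h (F y + jacobian F (at y) *v s) \<le> h (F (y + s))"
proof (rule h_mono)
  fix i
  let ?g = "\<lambda>t. F (y + t *\<^sub>R s) $ i"
  have "((\<lambda>t. F (y + t *\<^sub>R s)) has_derivative (\<lambda>e. e *\<^sub>R (jacobian F (at y) *v s))) (at 0)"
    using F_line_derivative[of y s 0] by simp
  then have "(?g has_derivative (\<lambda>e. (e *\<^sub>R (jacobian F (at y) *v s)) $ i)) (at 0)"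
    by (rule bounded_linear.has_derivative[OF bounded_linear_vec_nth])
  then have "(?g has_real_derivative (jacobian F (at y) *v s) $ i) (at 0)"
    by (simp add: has_field_derivative_def mult_commute_abs)
  moreover have "convex_on UNIV ?g"
  proof (rule convex_onI)
    fix t a b :: real assume t: "0 < t" "t < 1"
    have "y + ((1 - t) *\<^sub>R a + t *\<^sub>R b) *\<^sub>R s
      = (1 - t) *\<^sub>R (y + a *\<^sub>R s) + t *\<^sub>R (y + b *\<^sub>R s)"
      by (simp add: algebra_simps)
    then show "?g ((1 - t) *\<^sub>R a + t *\<^sub>R b) \<le> (1 - t) * ?g a + t * ?g b"
      using convex_onD[OF F_convex[of i], of t "y + a *\<^sub>R s" "y + b *\<^sub>R s"] t by simp
  qed simp
  ultimately have "?g 1 - ?g 0 \<ge> (jacobian F (at y) *v s) $ i * (1 - 0)"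
    by (intro convex_on_imp_above_tangent[where A = UNIV]) auto
  then show "(F y + jacobian F (at y) *v s) $ i \<le> F (y + s) $ i" by simp
qed

text \<open>The Taylor remainder and the finite-difference error each contribute
  \<open>LJ / 2 * (c2p * r)\<^sup>2\<close>, the latter because
  \<open>t * sqrt n \<le> r \<le> c2p * r\<close>.\<close>

lemma model_error:
  assumes t: "0 < t" "t * sqrt (real CARD('n)) \<le> r" and s: "pnorm p s \<le> r"
  shows "\<bar>h (F (y + s)) - h (F y + fd_jacobian F t y *v s)\<bar> \<le> Lh * LJ * cp2 * c2p\<^sup>2 * r\<^sup>2"
proof -
  let ?J = "jacobian F (at y)"
  have "0 \<le> t * sqrt (real CARD('n))" using t by simp
  then have r: "0 \<le> r" using t by linarith
  have ns: "norm s \<le> c2p * r" by (rule norm_le_radius[OF s])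
  have "norm (F (y + s) - (F y + fd_jacobian F t y *v s))
    \<le> norm (F (y + s) - F y - ?J *v s) + norm (fd_jacobian F t y *v s - ?J *v s)"
    by (rule order_trans[OF _ norm_triangle_ineq4]) (simp add: algebra_simps)
  also have "\<dots> \<le> LJ / 2 * (norm s)\<^sup>2 + LJ / 2 * (t * sqrt (real CARD('n))) * norm s"
    by (intro add_mono taylor_bound fd_jacobian_error t)
  also have "\<dots> \<le> LJ / 2 * (c2p * r)\<^sup>2 + LJ / 2 * (c2p * r) * (c2p * r)"
  proof (intro add_mono mult_mono[OF mult_left_mono] mult_left_mono power_mono)
    show "t * sqrt (real CARD('n)) \<le> c2p * r"
      using mult_mono[of 1 c2p "t * sqrt (real CARD('n))" r] t c2p(1) by simp
  qed (use ns LJ(1) c2p(1) r in auto)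
  also have "\<dots> = LJ * c2p\<^sup>2 * r\<^sup>2" by (simp add: power2_eq_square algebra_simps)
  finally have "Lh * cp2 * norm (F (y + s) - (F y + fd_jacobian F t y *v s)) \<le> Lh * cp2 * (LJ * c2p\<^sup>2 * r\<^sup>2)"
    using Lh cp2 by (intro mult_left_mono) auto
  then show ?thesis using h_lipschitz order_trans by (fastforce simp: mult_ac)
qed

text \<open>The point is that the infimum in \<open>eta\<close> is over values bounded below:
  admissible steps are bounded and \<open>h\<close> is Lipschitz.\<close>

lemma eta_ge:
  assumes "0 < r" "s \<in> steps p \<Omega> r y"
  shows "(h (F y) - h (F y + B *v s)) / r \<le> eta p \<Omega> F h r y B"
proof -
  have "bdd_below ((\<lambda>s. h (F y + B *v s)) ` steps p \<Omega> r y)"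
  proof (rule bdd_belowI2)
    fix s assume "s \<in> steps p \<Omega> r y"
    then have ns: "norm s \<le> c2p * r" by (simp add: steps_def norm_le_radius)
    have "0 \<le> spectral_norm B"
      unfolding spectral_norm_def by (rule onorm_pos_le[OF matrix_vector_mul_bounded_linear])
    then have "norm (B *v s) \<le> spectral_norm B * (c2p * r)"
      using norm_matrix_vector_le_spectral mult_left_mono[OF ns] order_trans by blast
    then have "Lh * cp2 * norm (B *v s) \<le> Lh * cp2 * (spectral_norm B * (c2p * r))"
      using Lh cp2 by (intro mult_left_mono) auto
    then show "h (F y) - Lh * cp2 * (spectral_norm B * (c2p * r)) \<le> h (F y + B *v s)"
      using h_lipschitz[of "F y" "F y + B *v s"] by simp
  qed
  then have "(INF s\<in>steps p \<Omega> r y. h (F y + B *v s)) \<le> h (F y + B *v s)"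
    using assms(2) by (rule cINF_lower)
  then show ?thesis using assms(1) by (simp add: eta_def divide_right_mono)
qed

text \<open>Shrinking a step of radius \<open>R\<close> by \<open>q = r / R\<close> keeps it
  admissible, as \<open>\<Omega>\<close> is convex, and retains at least the fraction
  \<open>q\<close> of its model decrease, as \<open>h\<close> is convex. Thus \<open>eta\<close> at
  the fixed large radius controls the decrease at every smaller one.\<close>

lemma exact_step_decrease:
  assumes r: "0 < r" "r \<le> R" and y: "y \<in> \<Omega>"
    and ds: "is_arg_min (\<lambda>s. h (F y + B *v s)) (\<lambda>s. s \<in> steps p \<Omega> r y) ds"
  shows "r * eta p \<Omega> F h R y B \<le> h (F y) - h (F y + B *v ds)"
proof -
  define q where "q = r / R"
  have q: "0 < q" "q \<le> 1" using r by (auto simp: q_def)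
  have "h (F y) - (h (F y) - h (F y + B *v ds)) / q \<le> (INF s\<in>steps p \<Omega> R y. h (F y + B *v s))"
  proof (rule cINF_greatest)
    show "steps p \<Omega> R y \<noteq> {}"
      using ds r by (fastforce simp: is_arg_min_def steps_def)
    fix s assume s: "s \<in> steps p \<Omega> R y"
    have "y + q *\<^sub>R s = (1 - q) *\<^sub>R y + q *\<^sub>R (y + s)" by (simp add: algebra_simps)
    then have "y + q *\<^sub>R s \<in> \<Omega>"
      using convexD_alt[OF Omega y, of "y + s" q] s q by (simp add: steps_def)
    moreover have "pnorm p (q *\<^sub>R s) \<le> r"
    proof -
      have "pnorm p (q *\<^sub>R s) \<le> q * R"
        using s q mult_left_mono[of "pnorm p s" R q] by (simp add: pnorm_scaleR[OF p] steps_def)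
      then show ?thesis using r by (simp add: q_def)
    qed
    ultimately have "h (F y + B *v ds) \<le> h (F y + B *v (q *\<^sub>R s))"
      using ds by (auto simp: is_arg_min_def steps_def not_less)
    also have "F y + B *v (q *\<^sub>R s) = (1 - q) *\<^sub>R F y + q *\<^sub>R (F y + B *v s)"
      by (simp add: matrix_vector_mult_scaleR algebra_simps)
    also have "h \<dots> \<le> (1 - q) * h (F y) + q * h (F y + B *v s)"
      using convex_onD[OF h_convex, of q "F y" "F y + B *v s"] q by simp
    finally show "h (F y) - (h (F y) - h (F y + B *v ds)) / q \<le> h (F y + B *v s)"
      using q by (simp add: field_simps)
  qed
  then have "q * (h (F y) - (INF s\<in>steps p \<Omega> R y. h (F y + B *v s))) \<le> h (F y) - h (F y + B *v ds)"
    using q by (simp add: field_simps)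
  then show ?thesis by (simp add: eta_def q_def)
qed

text \<open>The step \<open>z - y\<close> is admissible, and with the exact Jacobian its model value
  is at most \<open>h (F z)\<close>. Replacing the Jacobian by finite differences changes the model
  by at most \<open>R * E\<close>.\<close>

lemma gap_le_eta:
  assumes "y \<in> \<Omega>" "z \<in> \<Omega>" "pnorm p (z - y) \<le> R" "0 < R" "0 < t"
  shows "(h (F y) - h (F z)) / R
    \<le> eta p \<Omega> F h R y (fd_jacobian F t y)
      + LJ / 2 * (Lh * cp2 * c2p * (t * sqrt (real CARD('n))))"
proof -
  let ?s = "z - y" and ?J = "jacobian F (at y)" and ?A = "fd_jacobian F t y"
  define E where "E = LJ / 2 * (Lh * cp2 * c2p * (t * sqrt (real CARD('n))))"
  have "norm (?A *v ?s - ?J *v ?s) \<le> LJ / 2 * (t * sqrt (real CARD('n))) * (c2p * R)"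
    by (rule order_trans[OF fd_jacobian_error mult_left_mono[OF norm_le_radius]])
      (use LJ assms in auto)
  then have "Lh * cp2 * norm (?A *v ?s - ?J *v ?s)
      \<le> Lh * cp2 * (LJ / 2 * (t * sqrt (real CARD('n))) * (c2p * R))"
    using Lh cp2 by (intro mult_left_mono) auto
  then have "h (F y + ?A *v ?s) \<le> h (F y + ?J *v ?s) + R * E"
    using h_lipschitz[of "F y + ?A *v ?s" "F y + ?J *v ?s"] by (simp add: E_def mult_ac)
  also have "h (F y + ?J *v ?s) \<le> h (F z)"
    using linearization_below[of y ?s] by simp
  finally have "(h (F y) - h (F z)) / R \<le> (h (F y) - h (F y + ?A *v ?s) + R * E) / R"
    using assms by (intro divide_right_mono) auto
  also have "\<dots> = (h (F y) - h (F y + ?A *v ?s)) / R + E"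
    using assms by (simp add: add_divide_distrib)
  also have "(h (F y) - h (F y + ?A *v ?s)) / R \<le> eta p \<Omega> F h R y ?A"
    using assms by (intro eta_ge) (auto simp: steps_def)
  finally show ?thesis by (simp add: E_def)
qed

end

section \<open>Runs of the algorithm: constants and transitions\<close>

locale trfd_run = smooth_composite p \<Omega> F h Lh LJ c2p cp2
  for p :: enat and \<Omega> :: "(real^'n) set" and F :: "real^'n \<Rightarrow> real^'m" and h Lh LJ c2p cp2 +
  fixes \<epsilon> \<sigma> \<alpha> \<theta> \<Delta>max :: real
    and xstar :: "real^'n"
    and x d :: "nat \<Rightarrow> real^'n"
    and \<Delta> \<tau> :: "nat \<Rightarrow> real"
    and A :: "nat \<Rightarrow> real^'n^'m"
    and fresh :: "nat \<Rightarrow> bool"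
  assumes xstar: "is_arg_min (h \<circ> F) (\<lambda>y. y \<in> \<Omega>) xstar"
    and level_set: "\<And>y. y \<in> \<Omega> \<Longrightarrow> h (F y) \<le> h (F (x 0)) \<Longrightarrow> pnorm p (y - xstar) \<le> \<Delta>max"
    and params: "0 < \<epsilon>" "0 < \<sigma>" "0 < \<alpha>" "\<alpha> < 1" "0 < \<theta>" "\<theta> \<le> 1"
    and run: "trfd p \<Omega> F h Lh c2p cp2 \<epsilon> \<sigma> \<alpha> \<theta> \<Delta>max x \<Delta> \<tau> A d fresh"
begin

definition gap :: "nat \<Rightarrow> real" where
  "gap k = h (F (x k)) - h (F xstar)"

abbreviation step3 :: "nat \<Rightarrow> bool" where
  "step3 k \<equiv> reaches_step3 p \<Omega> F h \<epsilon> \<Delta>max x A fresh k"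

abbreviation accept :: "nat \<Rightarrow> bool" where
  "accept k \<equiv> \<alpha> \<le> rho F h (x k) (A k) (d k)"

definition crit :: "nat \<Rightarrow> real" where
  "crit k = eta p \<Omega> F h \<Delta>max (x k) (A k)"

text \<open>The constant in \<open>model_error\<close>.\<close>

definition err_const :: real where
  "err_const = Lh * LJ * cp2 * c2p\<^sup>2"

text \<open>The constant \<open>\<beta>\<close> of the theorem. The first argument of
  \<open>max\<close> serves the initial radius; the second serves a radius just halved by a
  rejection, whence its factor 2.\<close>

definition gap_ratio :: real where
  "gap_ratio = max (gap 0 / \<Delta> 0) (2 * (LJ / \<sigma> + 1) * \<Delta>max * err_const / ((1 - \<alpha>) * \<theta>))"

text \<open>The 4 combines \<open>crit k \<ge> \<epsilon> / 2\<close> at a rejection with the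
  halving that follows. Taking \<open>max \<sigma> LJ\<close> instead of \<open>LJ\<close> also puts
  the value below the initial radius.\<close>

definition \<Delta>min :: real where
  "\<Delta>min = (1 - \<alpha>) * \<theta> * \<epsilon> / (4 * Lh * max \<sigma> LJ * cp2 * c2p\<^sup>2)"

lemma run_init:
  "x 0 \<in> \<Omega>"
  "\<tau> 0 = \<epsilon> / (Lh * \<sigma> * cp2 * c2p * sqrt (real CARD('n)))"
  "\<tau> 0 * sqrt (real CARD('n)) \<le> \<Delta> 0"
  "\<Delta> 0 \<le> \<Delta>max"
  "fresh 0"
  using run unfolding trfd_def by blast+

lemma run_fresh: "fresh k \<Longrightarrow> A k = fd_jacobian F (\<tau> k) (x k)"
  using run by (simp add: trfd_def)

lemma run_step3: "step3 k \<Longrightarrow> inexact_step p \<Omega> F h \<theta> (\<Delta> k) (x k) (A k) (d k)"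
  using run unfolding trfd_def by meson

lemma run_accept:
  assumes "step3 k" "accept k"
  shows "x (Suc k) = x k + d k" "\<Delta> (Suc k) = min (2 * \<Delta> k) \<Delta>max" "\<tau> (Suc k) = \<tau> k" "fresh (Suc k)"
  using run assms unfolding trfd_def by metis+

lemma run_reject:
  assumes "step3 k" "\<not> accept k"
  shows "x (Suc k) = x k" "\<Delta> (Suc k) = \<Delta> k / 2"
    "if \<tau> k * sqrt (real CARD('n)) \<le> \<Delta> (Suc k)
      then \<tau> (Suc k) = \<tau> k \<and> A (Suc k) = A k \<and> \<not> fresh (Suc k)
      else \<tau> (Suc k) = \<tau> k / 2 \<and> fresh (Suc k)"
  using run assms unfolding trfd_def by meson+

lemma run_refine:
  assumes "\<not> step3 k"
  shows "x (Suc k) = x k" "\<Delta> (Suc k) = \<Delta> k" "\<tau> (Suc k) = \<tau> k / 2" "fresh (Suc k)"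
  using run assms unfolding trfd_def by meson+

section \<open>Decrease of the objective and invariants of the run\<close>

text \<open>The initial \<open>\<tau>\<close> is chosen so that the error term of
  \<open>gap_le_eta\<close> starts at \<open>LJ / 2 * (\<epsilon> / \<sigma>)\<close>.\<close>

lemma tau0: "0 < \<tau> 0" "Lh * cp2 * c2p * (\<tau> 0 * sqrt (real CARD('n))) = \<epsilon> / \<sigma>"
proof -
  have "0 < cp2" "0 < c2p" "0 < sqrt (real CARD('n))" using cp2 c2p by (auto simp: card_gt_0_iff)
  then show "0 < \<tau> 0" "Lh * cp2 * c2p * (\<tau> 0 * sqrt (real CARD('n))) = \<epsilon> / \<sigma>"
    using params Lh by (auto simp: run_init(2) field_simps)
qed

lemma err_const_pos: "0 < err_const"
  using Lh LJ cp2 c2p by (simp add: err_const_def)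

lemma step3_fresh: "fresh k \<Longrightarrow> step3 k \<longleftrightarrow> \<epsilon> / 2 \<le> crit k"
  by (simp add: reaches_step3_def crit_def)

lemma predicted_decrease:
  assumes "step3 k" "x k \<in> \<Omega>" "0 < \<Delta> k" "\<Delta> k \<le> \<Delta>max"
  shows "\<theta> * (\<Delta> k * crit k) \<le> h (F (x k)) - h (F (x k) + A k *v d k)"
proof -
  from run_step3[OF assms(1)] obtain ds where
    ds: "is_arg_min (\<lambda>s. h (F (x k) + A k *v s)) (\<lambda>s. s \<in> steps p \<Omega> (\<Delta> k) (x k)) ds"
    and d: "\<theta> * (h (F (x k)) - h (F (x k) + A k *v ds)) \<le> h (F (x k)) - h (F (x k) + A k *v d k)"
    unfolding inexact_step_def by blast
  have "\<Delta> k * crit k \<le> h (F (x k)) - h (F (x k) + A k *v ds)"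
    unfolding crit_def using exact_step_decrease[OF assms(3,4,2) ds] .
  then have "\<theta> * (\<Delta> k * crit k) \<le> \<theta> * (h (F (x k)) - h (F (x k) + A k *v ds))"
    using params by (intro mult_left_mono) auto
  then show ?thesis using d by simp
qed

lemma accepted_decrease:
  assumes "step3 k" "accept k" "x k \<in> \<Omega>" "0 < \<Delta> k" "\<Delta> k \<le> \<Delta>max" "0 < crit k"
  shows "\<alpha> * (\<theta> * (\<Delta> k * crit k)) \<le> h (F (x k)) - h (F (x (Suc k)))"
proof -
  have pred: "\<theta> * (\<Delta> k * crit k) \<le> h (F (x k)) - h (F (x k) + A k *v d k)"
    using assms by (intro predicted_decrease) auto
  \<comment> \<open>The denominator of \<open>rho\<close> is therefore positive and can be
    cleared.\<close>
  moreover have "0 < \<theta> * (\<Delta> k * crit k)" using assms params by simp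
  ultimately have "\<alpha> * (h (F (x k)) - h (F (x k) + A k *v d k)) \<le> h (F (x k)) - h (F (x (Suc k)))"
    using assms(2) by (simp add: rho_def run_accept(1)[OF assms(1,2)] pos_le_divide_eq)
  then show ?thesis using params by (intro order_trans[OF mult_left_mono[OF pred]]) auto
qed

text \<open>The parts need one another: an accepted step decreases the objective only because
  \<open>crit k\<close> is positive, and \<open>crit k \<ge> \<epsilon> / 2\<close> must also be
  known when Step 3 is entered without the test of Step 2.\<close>

lemma invariants:
  "x k \<in> \<Omega> \<and> h (F (x k)) \<le> h (F (x 0)) \<and> 0 < \<tau> k \<and> \<tau> k \<le> \<tau> 0 \<and>
   \<tau> k * sqrt (real CARD('n)) \<le> \<Delta> k \<and> \<Delta> k \<le> \<Delta>max \<and>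
   A k = fd_jacobian F (\<tau> k) (x k) \<and> (step3 k \<longrightarrow> \<epsilon> / 2 \<le> crit k)"
proof (induction k)
  case 0
  then show ?case
    using run_init run_fresh tau0 step3_fresh by simp
next
  case (Suc k)
  have n: "0 < sqrt (real CARD('n))" by simp
  from Suc have \<Delta>: "0 < \<Delta> k" using n by (meson less_le_trans mult_pos_pos)
  consider (acc) "step3 k" "accept k" | (rej) "step3 k" "\<not> accept k" | (ref) "\<not> step3 k" by blast
  then show ?case
  proof cases
    case acc
    have crit: "0 < crit k" using Suc acc params by auto
    have "0 \<le> \<alpha> * (\<theta> * (\<Delta> k * crit k))" using params \<Delta> crit by simp
    then have "h (F (x (Suc k))) \<le> h (F (x k))"
      using accepted_decrease[OF acc _ \<Delta> _ crit] Suc by linarith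
    moreover have "x (Suc k) \<in> \<Omega>"
      using run_step3[OF acc(1)] run_accept(1)[OF acc] by (simp add: inexact_step_def steps_def)
    ultimately show ?thesis
      using Suc \<Delta> run_accept[OF acc] run_fresh step3_fresh by (simp add: min_def)
  next
    case rej
    \<comment> \<open>When the matrix is reused, neither the point nor \<open>\<tau>\<close> has
      changed, so the matrix is still the right one and the earlier test remains valid.\<close>
    have "crit (Suc k) = crit k" "A (Suc k) = fd_jacobian F (\<tau> (Suc k)) (x (Suc k))"
      if "\<not> fresh (Suc k)"
      using that run_reject[OF rej] Suc by (auto simp: crit_def split: if_splits)
    then have "A (Suc k) = fd_jacobian F (\<tau> (Suc k)) (x (Suc k))" "step3 (Suc k) \<longrightarrow> \<epsilon> / 2 \<le> crit (Suc k)"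
      using run_fresh step3_fresh Suc rej by metis+
    moreover have "\<tau> (Suc k) * sqrt (real CARD('n)) \<le> \<Delta> (Suc k)"
    \<comment> \<open>If the halved radius is too small for \<open>\<tau> k\<close>, then
      \<open>\<tau>\<close> is halved as well and the old inequality is merely scaled.\<close>
    proof (cases "\<tau> k * sqrt (real CARD('n)) \<le> \<Delta> (Suc k)")
      case False
      then have "\<tau> (Suc k) = \<tau> k / 2" using run_reject(3)[OF rej] by simp
      then have "\<tau> (Suc k) * sqrt (real CARD('n)) = \<tau> k * sqrt (real CARD('n)) / 2"
        by (metis times_divide_eq_left)
      then show ?thesis using Suc by (simp only: run_reject(2)[OF rej]) simp
    qed (use run_reject(3)[OF rej] in auto)
    ultimately show ?thesis
      using Suc \<Delta> run_reject[OF rej] by (auto split: if_splits)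
  next
    case ref
    have "\<tau> (Suc k) * sqrt (real CARD('n)) \<le> \<tau> k * sqrt (real CARD('n))"
      unfolding run_refine(3)[OF ref] using Suc by (intro mult_right_mono) auto
    also have "\<dots> \<le> \<Delta> k" using Suc by simp
    finally have "\<tau> (Suc k) * sqrt (real CARD('n)) \<le> \<Delta> k" .
    moreover have "0 < \<tau> (Suc k)" "\<tau> (Suc k) \<le> \<tau> 0"
      unfolding run_refine(3)[OF ref] using Suc by auto
    ultimately show ?thesis
      using Suc run_refine(1,2,4)[OF ref] run_fresh step3_fresh by auto
  qed
qed

section \<open>Relations between gap, criticality measure and radius\<close>

lemma Delta_pos: "0 < \<Delta> k"
proof -
  have "0 < \<tau> k * sqrt (real CARD('n))" using invariants[of k] by simp
  then show ?thesis using invariants[of k] by linarith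
qed

lemma Deltamax_pos: "0 < \<Delta>max"
  using Delta_pos[of 0] run_init(4) by linarith

lemma crit_pos: "step3 k \<Longrightarrow> 0 < crit k"
  using invariants[of k] params by auto

lemma gap_nonneg: "0 \<le> gap k"
  using xstar invariants[of k] by (auto simp: is_arg_min_def gap_def not_less)

text \<open>\<open>gap_le_eta\<close> towards \<open>xstar\<close>, which lies within
  \<open>\<Delta>max\<close> because the run stays in the initial level set. Writing the error in
  terms of \<open>\<tau> k / \<tau> 0\<close> lets it bound the gap in Step 3 and
  \<open>\<tau> k\<close> from below in Step 2.\<close>

lemma gap_bound:
  "gap k / \<Delta>max \<le> crit k + LJ / 2 * (\<epsilon> / \<sigma> * (\<tau> k / \<tau> 0))"
proof -
  have "pnorm p (xstar - x k) \<le> \<Delta>max"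
    using level_set[of "x k"] invariants[of k] pnorm_minus_commute[OF p, of xstar "x k"] by simp
  then have "gap k / \<Delta>max \<le> crit k + LJ / 2 * (Lh * cp2 * c2p * (\<tau> k * sqrt (real CARD('n))))"
    unfolding gap_def crit_def
    using gap_le_eta[of "x k" xstar \<Delta>max "\<tau> k"] invariants[of k] xstar Deltamax_pos
    by (simp add: is_arg_min_def)
  also have "Lh * cp2 * c2p * (\<tau> k * sqrt (real CARD('n))) = \<epsilon> / \<sigma> * (\<tau> k / \<tau> 0)"
    unfolding tau0(2)[symmetric] using tau0(1) by simp
  finally show ?thesis .
qed

text \<open>In Step 3 the error term is at most \<open>LJ / \<sigma> * (\<epsilon> / 2)\<close>, and
  \<open>\<epsilon> / 2 \<le> crit k\<close> absorbs it.\<close>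

lemma gap_le_crit:
  assumes "step3 k"
  shows "gap k \<le> (LJ / \<sigma> + 1) * \<Delta>max * crit k"
proof -
  have "LJ / 2 * (\<epsilon> / \<sigma> * (\<tau> k / \<tau> 0)) \<le> LJ / 2 * (\<epsilon> / \<sigma> * 1)"
    using LJ params invariants[of k] tau0 by (intro mult_left_mono) auto
  also have "\<dots> = LJ / \<sigma> * (\<epsilon> / 2)" by simp
  also have "\<dots> \<le> LJ / \<sigma> * crit k"
    using LJ params invariants[of k] assms by (intro mult_left_mono) auto
  finally have "gap k / \<Delta>max \<le> (LJ / \<sigma> + 1) * crit k"
    using gap_bound[of k] by (simp add: algebra_simps)
  then show ?thesis using Deltamax_pos by (simp add: pos_divide_le_eq mult_ac)
qed

text \<open>A rejection means that predicted and actual decrease differ by more than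
  \<open>(1 - \<alpha>) * pred\<close>, yet they differ by at most
  \<open>err_const * (\<Delta> k)\<^sup>2\<close>. One factor \<open>\<Delta> k\<close>
  cancels.\<close>

lemma rejected_radius:
  assumes "step3 k" "\<not> accept k"
  shows "(1 - \<alpha>) * \<theta> * crit k < err_const * \<Delta> k"
proof -
  define pred where "pred = h (F (x k)) - h (F (x k) + A k *v d k)"
  define ared where "ared = h (F (x k)) - h (F (x k + d k))"
  have pred: "\<theta> * (\<Delta> k * crit k) \<le> pred"
    unfolding pred_def using assms invariants Delta_pos by (intro predicted_decrease) auto
  have pos: "0 < \<theta> * (\<Delta> k * crit k)" using crit_pos[OF assms(1)] Delta_pos params by simp
  have "ared < \<alpha> * pred"
    using assms(2) pred pos
    by (simp add: rho_def pred_def[symmetric] ared_def[symmetric] not_le pos_divide_less_eq)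
  moreover have "\<bar>pred - ared\<bar> \<le> err_const * (\<Delta> k)\<^sup>2"
    using model_error[of "\<tau> k" "\<Delta> k" "d k" "x k"] invariants[of k] run_step3[OF assms(1)]
    by (simp add: inexact_step_def steps_def err_const_def pred_def ared_def)
  ultimately have "(1 - \<alpha>) * pred < err_const * (\<Delta> k)\<^sup>2"
    by (simp add: algebra_simps)
  moreover have "(1 - \<alpha>) * (\<theta> * (\<Delta> k * crit k)) \<le> (1 - \<alpha>) * pred"
    using pred params by (intro mult_left_mono) auto
  ultimately have "((1 - \<alpha>) * \<theta> * crit k) * \<Delta> k < (err_const * \<Delta> k) * \<Delta> k"
    by (simp add: power2_eq_square mult_ac)
  then show ?thesis using Delta_pos[of k] by simp
qed

text \<open>Acceptance neither raises the gap nor lowers the radius. At a rejection the gap is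
  bounded by \<open>crit k\<close>, and \<open>crit k\<close> by the radius.\<close>

lemma gap_le_radius: "gap k \<le> gap_ratio * \<Delta> k"
proof (induction k)
  case 0
  have "gap 0 / \<Delta> 0 \<le> gap_ratio" by (simp add: gap_ratio_def)
  then show ?case using Delta_pos[of 0] by (simp add: pos_divide_le_eq)
next
  case (Suc k)
  have "0 \<le> gap 0 / \<Delta> 0" using gap_nonneg Delta_pos[of 0] by simp
  then have gap_ratio: "0 \<le> gap_ratio" by (simp add: gap_ratio_def)
  consider (acc) "step3 k" "accept k" | (rej) "step3 k" "\<not> accept k" | (ref) "\<not> step3 k" by blast
  then show ?case
  proof cases
    case acc
    have "0 \<le> \<alpha> * (\<theta> * (\<Delta> k * crit k))" using params Delta_pos[of k] crit_pos[OF acc(1)] by simp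
    then have "gap (Suc k) \<le> gap k"
      using accepted_decrease[OF acc] invariants[of k] Delta_pos[of k] crit_pos[OF acc(1)]
      by (simp add: gap_def)
    moreover have "\<Delta> k \<le> \<Delta> (Suc k)"
      using run_accept(2)[OF acc] Delta_pos[of k] invariants[of k] by simp
    ultimately show ?thesis using Suc gap_ratio mult_left_mono[of "\<Delta> k" "\<Delta> (Suc k)" gap_ratio] by linarith
  next
    case rej
    let ?K = "(LJ / \<sigma> + 1) * \<Delta>max" and ?q = "(1 - \<alpha>) * \<theta>"
    have pos: "0 < ?K" "0 < ?q" using LJ params Deltamax_pos by (auto intro!: mult_pos_pos add_pos_pos)
    have "gap (Suc k) \<le> ?K * crit k"
      using gap_le_crit[OF rej(1)] run_reject(1)[OF rej] by (simp add: gap_def)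
    also have "\<dots> = ?K / ?q * (?q * crit k)" using params by simp
    also have "\<dots> \<le> ?K / ?q * (err_const * \<Delta> k)"
      using rejected_radius[OF rej] pos by (intro mult_left_mono) auto
    also have "\<dots> = 2 * ?K * err_const / ?q * \<Delta> (Suc k)"
      by (simp add: run_reject(2)[OF rej])
    also have "2 * ?K * err_const / ?q * \<Delta> (Suc k) \<le> gap_ratio * \<Delta> (Suc k)"
    proof (rule mult_right_mono)
      show "2 * ?K * err_const / ?q \<le> gap_ratio"
        unfolding gap_ratio_def by (rule max.coboundedI2) (simp only: mult.assoc order.refl)
    qed (use Delta_pos[of "Suc k"] in simp)
    finally show ?thesis .
  next
    case ref
    then show ?thesis using Suc run_refine[OF ref] by (simp add: gap_def)
  qed
qed

lemma Deltamin_pos: "0 < \<Delta>min"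
  using params Lh cp2 c2p LJ by (simp add: \<Delta>min_def)

text \<open>Only rejections shrink the radius, and \<open>rejected_radius\<close> keeps it above a
  multiple of \<open>\<epsilon>\<close>.\<close>

lemma Deltamin_le: "\<Delta>min \<le> \<Delta> k"
proof (induction k)
  case 0
  have "(1 - \<alpha>) * \<theta> \<le> 1 * 1" using params by (intro mult_mono) auto
  then have "\<Delta>min \<le> \<epsilon> / (4 * Lh * max \<sigma> LJ * cp2 * c2p\<^sup>2)"
    unfolding \<Delta>min_def using params Lh cp2 c2p LJ by (intro divide_right_mono) auto
  also have "\<dots> \<le> \<epsilon> / (Lh * \<sigma> * cp2 * c2p)"
  proof (rule divide_left_mono)
    have "Lh * \<sigma> * cp2 * c2p \<le> (4 * Lh) * max \<sigma> LJ * cp2 * c2p\<^sup>2"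
      using params Lh cp2 c2p LJ by (intro mult_mono) (auto simp: power2_eq_square)
    then show "Lh * \<sigma> * cp2 * c2p \<le> 4 * Lh * max \<sigma> LJ * cp2 * c2p\<^sup>2" by simp
  qed (use params Lh cp2 c2p in auto)
  also have "\<dots> = \<tau> 0 * sqrt (real CARD('n))" by (simp add: run_init(2))
  finally show ?case using run_init(3) by simp
next
  case (Suc k)
  consider (acc) "step3 k" "accept k" | (rej) "step3 k" "\<not> accept k" | (ref) "\<not> step3 k" by blast
  then show ?case
  proof cases
    case acc
    then show ?thesis
      using Suc run_accept(2)[OF acc] invariants[of k] Delta_pos[of k] by simp
  next
    case rej
    have "(1 - \<alpha>) * \<theta> * (\<epsilon> / 2) \<le> (1 - \<alpha>) * \<theta> * crit k"
      using params invariants[of k] rej by (intro mult_left_mono) auto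
    also have "\<dots> < err_const * \<Delta> k" using rejected_radius[OF rej] .
    finally have "(1 - \<alpha>) * \<theta> * \<epsilon> / (4 * err_const) \<le> \<Delta> (Suc k)"
      using err_const_pos by (simp add: run_reject(2)[OF rej] field_simps)
    moreover have "\<Delta>min \<le> (1 - \<alpha>) * \<theta> * \<epsilon> / (4 * err_const)"
      unfolding \<Delta>min_def err_const_def using params Lh cp2 c2p LJ
      by (intro divide_left_mono) (auto intro!: mult_mono)
    ultimately show ?thesis by simp
  next
    case ref
    then show ?thesis using Suc run_refine[OF ref] by simp
  qed
qed

lemma gap_ratio_pos: "0 < gap_ratio"
proof -
  have "0 < 2 * (LJ / \<sigma> + 1) * \<Delta>max * err_const / ((1 - \<alpha>) * \<theta>)"
    using LJ params Deltamax_pos err_const_pos by (auto intro!: divide_pos_pos mult_pos_pos add_pos_pos)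
  then show ?thesis by (simp add: gap_ratio_def)
qed

text \<open>One factor of \<open>(gap k)\<^sup>2\<close> is bounded through the radius, the other
  through \<open>crit k\<close>; an accepted step gains a multiple of their product.\<close>

lemma accepted_gap:
  assumes "step3 k" "accept k"
  shows "gap (Suc k) \<le> gap k - \<alpha> * \<theta> / ((LJ / \<sigma> + 1) * gap_ratio * \<Delta>max) * (gap k)\<^sup>2"
proof -
  define K where "K = (LJ / \<sigma> + 1) * \<Delta>max"
  have K: "0 < K" unfolding K_def using LJ params Deltamax_pos by (auto intro!: mult_pos_pos add_pos_pos)
  have "gap k \<le> K * crit k" using gap_le_crit[OF assms(1)] by (simp add: K_def)
  then have "gap k * gap k \<le> (gap_ratio * \<Delta> k) * (K * crit k)"
    using gap_le_radius gap_nonneg by (intro mult_mono) (auto intro: order_trans)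
  then have "(gap k)\<^sup>2 / (K * gap_ratio) \<le> \<Delta> k * crit k"
    using K gap_ratio_pos by (simp add: pos_divide_le_eq power2_eq_square mult_ac)
  then have "\<alpha> * \<theta> * ((gap k)\<^sup>2 / (K * gap_ratio)) \<le> \<alpha> * \<theta> * (\<Delta> k * crit k)"
    using params by (intro mult_left_mono) auto
  moreover have "\<alpha> * (\<theta> * (\<Delta> k * crit k)) \<le> gap k - gap (Suc k)"
    using accepted_decrease[OF assms] invariants[of k] Delta_pos[of k] crit_pos[OF assms(1)]
    by (simp add: gap_def)
  moreover have "K * gap_ratio = (LJ / \<sigma> + 1) * gap_ratio * \<Delta>max" by (simp add: K_def)
  ultimately show ?thesis by simp
qed

section \<open>Iteration and evaluation counts\<close>

lemma iterations_before_target: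
  assumes "\<And>k. k < N \<Longrightarrow> \<Delta>max * \<epsilon> < gap k"
  shows "real N \<le> 2 * (1 + (LJ / \<sigma> + 1) * gap_ratio / (\<alpha> * \<theta>) * (1 / \<epsilon>))
    + log 2 (2 * (max \<sigma> LJ / \<sigma>)) + log 2 (\<Delta> 0 / \<Delta>min)"
proof -
  define c where "c = \<alpha> * \<theta> / ((LJ / \<sigma> + 1) * gap_ratio * \<Delta>max)"
  have c: "0 < c"
    unfolding c_def using LJ params Deltamax_pos gap_ratio_pos
    by (auto intro!: divide_pos_pos mult_pos_pos add_pos_pos)
  have "real N \<le> 2 * (1 + 1 / (c * (\<Delta>max * \<epsilon>))) + log 2 (2 * (max \<sigma> LJ / \<sigma>)) + log 2 (\<Delta> 0 / \<Delta>min)"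
  proof (rule iteration_count[where \<delta> = gap and \<tau> = \<tau>])
    fix k assume "k < N"
    then have gap: "\<Delta>max * \<epsilon> < gap k" by (rule assms)
    consider (acc) "step3 k" "accept k" | (rej) "step3 k" "\<not> accept k" | (ref) "\<not> step3 k" by blast
    then show "gap (Suc k) \<le> gap k - c * (gap k)\<^sup>2 \<and> \<Delta> (Suc k) \<le> 2 * \<Delta> k \<and> \<tau> (Suc k) \<le> \<tau> k \<or>
      gap (Suc k) = gap k \<and> \<Delta> (Suc k) = \<Delta> k \<and> \<tau> (Suc k) = \<tau> k / 2 \<and> \<tau> 0 \<le> max \<sigma> LJ / \<sigma> * \<tau> k \<or>
      gap (Suc k) = gap k \<and> \<Delta> (Suc k) = \<Delta> k / 2 \<and> \<tau> (Suc k) \<le> \<tau> k"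
    proof cases
      case acc
      then show ?thesis using accepted_gap[OF acc] run_accept[OF acc] by (simp add: c_def)
    next
      case rej
      then show ?thesis
        using run_reject[OF rej] invariants[of k] by (auto simp: gap_def split: if_splits)
    next
      case ref
      \<comment> \<open>Since \<open>crit k\<close> accounts for less than
        \<open>\<epsilon> / 2\<close>, the finite-difference error must exceed
        \<open>\<epsilon> / 2\<close>, which is impossible for small
        \<open>\<tau> k\<close>.\<close>
      have "\<epsilon> < gap k / \<Delta>max" using gap Deltamax_pos by (simp add: pos_less_divide_eq mult.commute)
      moreover have "crit k < \<epsilon> / 2" using ref by (auto simp: reaches_step3_def crit_def)
      ultimately have "\<epsilon> < LJ * (\<epsilon> / \<sigma> * (\<tau> k / \<tau> 0))" using gap_bound[of k] by simp
      then have "\<epsilon> * \<tau> 0 < \<epsilon> * (LJ / \<sigma> * \<tau> k)" using tau0(1) params(2) by (simp add: field_simps)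
      then have "\<tau> 0 < LJ / \<sigma> * \<tau> k" using params by (simp only: mult_less_cancel_left_pos)
      also have "\<dots> \<le> max \<sigma> LJ / \<sigma> * \<tau> k"
        using params invariants[of k] by (intro mult_right_mono divide_right_mono) auto
      finally show ?thesis using run_refine[OF ref] by (simp add: gap_def)
    qed
  qed (use c params Deltamax_pos Deltamin_pos invariants Deltamin_le assms in auto)
  \<comment> \<open>\<open>\<Delta>max\<close> cancels between \<open>c\<close> and the target
    \<open>\<Delta>max * \<epsilon>\<close>.\<close>
  also have "1 / (c * (\<Delta>max * \<epsilon>)) = (LJ / \<sigma> + 1) * gap_ratio / (\<alpha> * \<theta>) * (1 / \<epsilon>)"
    using Deltamax_pos by (simp add: c_def)
  finally show ?thesis .
qed

lemma evals_before_target: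
  assumes "\<And>k. k < N \<Longrightarrow> \<Delta>max * \<epsilon> < gap k"
  shows "real (evals_before p \<Omega> F h \<epsilon> \<Delta>max x A fresh N)
      \<le> (real CARD('n) + 1) *
         (2 * (1 + (LJ / \<sigma> + 1) * gap_ratio / (\<alpha> * \<theta>) * (1 / \<epsilon>))
          + real_of_int \<lceil>\<bar>log 2 (4 * max \<sigma> LJ * c2p / (\<sigma> * (1 - \<alpha>) * \<theta>))\<bar>\<rceil>
          + log 2 (4 * Lh * max \<sigma> LJ * cp2 * c2p\<^sup>2 * \<Delta> 0 / ((1 - \<alpha>) * \<theta>) * (1 / \<epsilon>)))"
    (is "_ \<le> _ * (?S + real_of_int \<lceil>\<bar>?L\<bar>\<rceil> + ?M)")
proof -
  define b where "b = max \<sigma> LJ / \<sigma>"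
  have b: "0 < b" using params by (simp add: b_def)
  have q: "0 < (1 - \<alpha>) * \<theta>" "(1 - \<alpha>) * \<theta> \<le> 1" using params mult_mono[of "1 - \<alpha>" 1 \<theta> 1] by auto
  \<comment> \<open>The argument of the logarithm exceeds \<open>2 * b\<close> by at least another
    factor 2, as \<open>c2p \<ge> 1\<close> and \<open>(1 - \<alpha>) * \<theta> \<le> 1\<close>.
    The resulting 1 turns \<open>N\<close> into \<open>N + 1\<close> and so pays for
    \<open>F (x 0)\<close>.\<close>
  have "(4 * b) * 1 \<le> (4 * b) * (c2p / ((1 - \<alpha>) * \<theta>))"
    using b q c2p by (intro mult_left_mono) auto
  then have "2 * (2 * b) \<le> 4 * max \<sigma> LJ * c2p / (\<sigma> * (1 - \<alpha>) * \<theta>)"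
    by (simp add: b_def mult_ac)
  then have "log 2 (2 * (2 * b)) \<le> ?L" using b by (intro log_mono) auto
  moreover have "log 2 (2 * (2 * b)) = 1 + log 2 (2 * b)"
    using b by (subst log_mult) auto
  moreover have "?L \<le> real_of_int \<lceil>\<bar>?L\<bar>\<rceil>"
    by (rule order_trans[OF abs_ge_self le_of_int_ceiling])
  moreover have "\<Delta> 0 / \<Delta>min = 4 * Lh * max \<sigma> LJ * cp2 * c2p\<^sup>2 * \<Delta> 0 / ((1 - \<alpha>) * \<theta>) * (1 / \<epsilon>)"
    by (simp add: \<Delta>min_def)
  ultimately have N: "real N + 1 \<le> ?S + real_of_int \<lceil>\<bar>?L\<bar>\<rceil> + ?M"
    using iterations_before_target[of N, OF assms] by (simp add: b_def)
  have "evals_before p \<Omega> F h \<epsilon> \<Delta>max x A fresh N \<le> 1 + (\<Sum>k<N. CARD('n) + 1)"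
    unfolding evals_before_def by (intro add_left_mono sum_mono) auto
  also have "\<dots> \<le> (CARD('n) + 1) * (N + 1)" by simp
  finally have "real (evals_before p \<Omega> F h \<epsilon> \<Delta>max x A fresh N) \<le> real ((CARD('n) + 1) * (N + 1))"
    by (rule of_nat_mono)
  also have "\<dots> = (real CARD('n) + 1) * (real N + 1)" by (simp add: algebra_simps)
  also have "\<dots> \<le> (real CARD('n) + 1) * (?S + real_of_int \<lceil>\<bar>?L\<bar>\<rceil> + ?M)"
    using N by (intro mult_left_mono) auto
  finally show ?thesis .
qed

text \<open>The bound of \<open>iterations_before_target\<close> does not depend on
  \<open>N\<close>.\<close>

lemma target_reached: "\<exists>k. gap k \<le> \<Delta>max * \<epsilon>"
proof (rule ccontr)
  assume "\<not> ?thesis"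
  then have "\<And>k. \<Delta>max * \<epsilon> < gap k" by (simp add: not_le)
  from iterations_before_target[OF this] show False
    by (meson reals_Archimedean2 not_le)
qed

end

theorem corollary3p16:
  fixes p :: enat
    and \<Omega> :: "(real^'n) set"
    and F :: "real^'n \<Rightarrow> real^'m"
    and h :: "real^'m \<Rightarrow> real"
    and f :: "real^'n \<Rightarrow> real"
    and Lh LJ c2p cp2 f_low \<epsilon> \<sigma> \<alpha> \<theta> \<Delta>max D0 \<beta> :: real
    and xstar :: "real^'n"
    and x d :: "nat \<Rightarrow> real^'n"
    and \<Delta> \<tau> :: "nat \<Rightarrow> real"
    and A :: "nat \<Rightarrow> real^'n^'m"
    and fresh :: "nat \<Rightarrow> bool"
    and T :: enat
  assumes p: "1 \<le> p"
    and c2p: "1 \<le> c2p" "\<And>v :: real^'n. norm v \<le> c2p * pnorm p v"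
    and cp2: "1 \<le> cp2" "\<And>z :: real^'m. pnorm p z \<le> cp2 * norm z"
    and Omega: "\<Omega> \<noteq> {}" "closed \<Omega>" "convex \<Omega>"
    and F_diff: "\<And>y. F differentiable (at y)"
    and LJ: "0 < LJ"
      "\<And>y z. spectral_norm (jacobian F (at y) - jacobian F (at z)) \<le> LJ * norm (y - z)"
    and h_convex: "convex_on UNIV h"
    and Lh: "0 < Lh" "\<And>z w. \<bar>h z - h w\<bar> \<le> Lh * pnorm p (z - w)"
    and f_def: "f = h \<circ> F"
    and f_low: "\<And>y. f_low \<le> f y"
    and F_convex: "\<And>i. convex_on UNIV (\<lambda>y. F y $ i)"
    and h_mono: "\<And>u v. (\<And>i. u $ i \<le> v $ i) \<Longrightarrow> h u \<le> h v"
    and xstar: "is_arg_min f (\<lambda>y. y \<in> \<Omega>) xstar"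
    and D0_finite: "bdd_above {pnorm p (y - xstar) | y. y \<in> \<Omega> \<and> f y \<le> f (x 0)}"
    and D0_def: "D0 = Sup {pnorm p (y - xstar) | y. y \<in> \<Omega> \<and> f y \<le> f (x 0)}"
    and params: "0 < \<epsilon>" "0 < \<sigma>" "0 < \<alpha>" "\<alpha> < 1" "0 < \<theta>" "\<theta> \<le> 1"
    and run: "trfd p \<Omega> F h Lh c2p cp2 \<epsilon> \<sigma> \<alpha> \<theta> \<Delta>max x \<Delta> \<tau> A d fresh"
    and T_def: "T = hitting_time f x xstar (\<Delta>max * \<epsilon>)"
    and beta_def: "\<beta> = max ((f (x 0) - f xstar) / \<Delta> 0)
      (2 * (LJ / \<sigma> + 1) * \<Delta>max * Lh * LJ * cp2 * c2p\<^sup>2 / ((1 - \<alpha>) * \<theta>))"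
    and Delta_max: "D0 \<le> \<Delta>max"
  shows "T \<noteq> \<infinity> \<and>
    real (evals_before p \<Omega> F h \<epsilon> \<Delta>max x A fresh (the_enat T))
      \<le> (real CARD('n) + 1) *
         (2 * (1 + (LJ / \<sigma> + 1) * \<beta> / (\<alpha> * \<theta>) * (1 / \<epsilon>))
          + real_of_int \<lceil>\<bar>log 2 (4 * max \<sigma> LJ * c2p / (\<sigma> * (1 - \<alpha>) * \<theta>))\<bar>\<rceil>
          + log 2 (4 * Lh * max \<sigma> LJ * cp2 * c2p\<^sup>2 * \<Delta> 0 / ((1 - \<alpha>) * \<theta>) * (1 / \<epsilon>)))"
proof -
  interpret trfd_run p \<Omega> F h Lh LJ c2p cp2 \<epsilon> \<sigma> \<alpha> \<theta> \<Delta>max xstar x d \<Delta> \<tau> A fresh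
  proof unfold_locales
    \<comment> \<open>This is where \<open>D0 \<le> \<Delta>max\<close> enters; finiteness of the
      supremum makes \<open>D0\<close> an upper bound.\<close>
    fix y assume "y \<in> \<Omega>" "h (F y) \<le> h (F (x 0))"
    then have "pnorm p (y - xstar) \<le> D0"
      unfolding D0_def by (intro cSup_upper[OF _ D0_finite]) (auto simp: f_def)
    then show "pnorm p (y - xstar) \<le> \<Delta>max" using Delta_max by simp
  qed (use assms in auto)
  have gap: "f (x k) - f xstar = gap k" for k by (simp add: gap_def f_def)
  have \<beta>: "\<beta> = gap_ratio"
    by (simp only: beta_def gap_ratio_def gap_def err_const_def f_def o_apply mult.assoc)
  define N where "N = (LEAST k. gap k \<le> \<Delta>max * \<epsilon>)"
  have N: "gap N \<le> \<Delta>max * \<epsilon>" unfolding N_def using target_reached by (rule LeastI_ex)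
  have before: "\<Delta>max * \<epsilon> < gap k" if "k < N" for k
    using not_less_Least[of k "\<lambda>k. gap k \<le> \<Delta>max * \<epsilon>"] that by (simp add: N_def)
  have "T = enat N"
    unfolding T_def hitting_time_def gap
    by (rule Inf_eqI) (use N before in \<open>force simp: not_le[symmetric]\<close>)+
  then show ?thesis using evals_before_target[OF before] by (simp add: \<beta>)
qed

end
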